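(* For $n\ge 0$ let $C_n(u,\alpha)=\sum_{i=0}^n\binom ni (\alpha)_i\,u^{n-i}$. Then, as formal power series in $x$ and $y$, \[\sum_{m,n\ge0} C_{2m+n}(u,\alpha)\frac{x^m}{m!}\frac{y^n}{n!}=e^{u^2x+uy}\sum_{k\ge0}\frac{(\alpha)_{2k}}{(1-2ux-y)^{2k+\alpha}}\frac{x^k}{k!}.\]
   Context: $(\alpha)_n=\alpha(\alpha+1)\cdots(\alpha+n-1)$ is the rising factorial with $(\alpha)_0=1$; $u$ and $\alpha$ are indeterminates (or complex parameters), and negative/real powers of $1-2ux-y$ denote formal binomial series. *)

theory Defs
  imports "HOL-Computational_Algebra.Formal_Power_Series"
begin

text \<open>
  Bivariate formal power series in \<open>x\<close> and \<open>y\<close> over \<open>'a\<close> are represented as power series in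
  \<open>x\<close> whose coefficients are power series in \<open>y\<close>: the coefficient of \<open>x ^ m * y ^ n\<close> in \<open>F\<close> is
  \<open>fps_nth (fps_nth F m) n\<close>.
\<close>

type_synonym 'a bfps = "'a fps fps"

definition bfps_coeff :: "'a bfps \<Rightarrow> nat \<Rightarrow> nat \<Rightarrow> 'a" where
  "bfps_coeff F m n = fps_nth (fps_nth F m) n"

definition Abs_bfps :: "(nat \<Rightarrow> nat \<Rightarrow> 'a) \<Rightarrow> 'a bfps" where
  "Abs_bfps f = Abs_fps (\<lambda>m. Abs_fps (\<lambda>n. f m n))"

definition bfps_const :: "'a::zero \<Rightarrow> 'a bfps" where
  "bfps_const c = fps_const (fps_const c)"

definition bfps_X :: "'a::{zero,one} bfps" where
  "bfps_X = fps_X"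

definition bfps_Y :: "'a::{zero,one} bfps" where
  "bfps_Y = fps_const fps_X"

text \<open>
  Substitution of a bivariate series \<open>S\<close> without constant term into a univariate series
  \<open>f\<close>, i.e. the formal sum of all \<open>f\<^sub>j * S ^ j\<close>. Only the terms with \<open>j \<le> m + n\<close> contribute to
  the coefficient of \<open>x ^ m * y ^ n\<close> (lemma \<open>bfps_coeff_compose\<close> below). The library's
  \<^const>\<open>fps_compose\<close> and the metric of \<^typ>\<open>'a fps fps\<close> are not applicable here: both
  are \<open>x\<close>-adic, so that they do not allow for substituting a series such as \<open>y\<close>.
\<close>

definition bfps_compose :: "'a::comm_ring_1 fps \<Rightarrow> 'a bfps \<Rightarrow> 'a bfps" where
  "bfps_compose f S = Abs_bfps (\<lambda>m n. \<Sum>j=0..m+n. fps_nth f j * bfps_coeff (S ^ j) m n)"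

definition bfps_exp :: "'a::field_char_0 bfps \<Rightarrow> 'a bfps" where
  "bfps_exp S = bfps_compose (fps_exp 1) S"

text \<open>The binomial series of \<open>P\<close> to the exponent \<open>a\<close>, for \<open>P\<close> with constant term 1.\<close>

definition bfps_power :: "'a::field_char_0 bfps \<Rightarrow> 'a \<Rightarrow> 'a bfps" where
  "bfps_power P a = bfps_compose (fps_binomial a) (P - 1)"

definition C :: "nat \<Rightarrow> 'a::field_char_0 \<Rightarrow> 'a \<Rightarrow> 'a" where
  "C n u \<alpha> = (\<Sum>i=0..n. of_nat (n choose i) * pochhammer \<alpha> i * u ^ (n - i))"

lemma bfps_coeff_power_eq_0:
  fixes S :: "'a::comm_ring_1 bfps"
  assumes "bfps_coeff S 0 0 = 0" and "m + n < j"
  shows "bfps_coeff (S ^ j) m n = 0"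
  using assms(2)
proof (induction j arbitrary: m n)
  case (Suc j)
  have "fps_nth (fps_nth S i * fps_nth (S ^ j) (m - i)) n = 0" if "i \<le> m" for i
  proof -
    have "fps_nth (fps_nth S i) l * fps_nth (fps_nth (S ^ j) (m - i)) (n - l) = 0" if "l \<le> n" for l
    proof (cases "i = 0 \<and> l = 0")
      case True
      then show ?thesis using assms(1) by (simp add: bfps_coeff_def)
    next
      case False
      with \<open>i \<le> m\<close> \<open>l \<le> n\<close> Suc.prems have "m - i + (n - l) < j" by linarith
      from Suc.IH[OF this] show ?thesis by (simp add: bfps_coeff_def)
    qed
    then show ?thesis by (simp add: fps_mult_nth)
  qed
  then show ?case by (simp add: bfps_coeff_def fps_mult_nth fps_sum_nth)
qed simp

lemma bfps_coeff_compose: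
  fixes S :: "'a::comm_ring_1 bfps"
  assumes "bfps_coeff S 0 0 = 0" and "m + n \<le> N"
  shows "bfps_coeff (bfps_compose f S) m n = (\<Sum>j=0..N. fps_nth f j * bfps_coeff (S ^ j) m n)"
proof -
  have "(\<Sum>j=0..m+n. fps_nth f j * bfps_coeff (S ^ j) m n)
      = (\<Sum>j=0..N. fps_nth f j * bfps_coeff (S ^ j) m n)"
    using assms by (intro sum.mono_neutral_left) (auto simp: bfps_coeff_power_eq_0)
  then show ?thesis
    by (simp add: bfps_compose_def Abs_bfps_def bfps_coeff_def)
qed

text \<open>Any series of this shape converges in the (\<open>x\<close>-adic) metric of \<^typ>\<open>'a fps fps\<close>.\<close>

lemma summable_bfps_X:
  fixes G :: "nat \<Rightarrow> 'a::comm_ring_1 bfps"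
  shows "summable (\<lambda>k. G k * bfps_X ^ k)"
proof -
  have "(\<lambda>N. \<Sum>k<N. G k * bfps_X ^ k) \<longlonglongrightarrow> Abs_fps (\<lambda>m. \<Sum>k\<le>m. fps_nth (G k) (m - k))"
  proof (rule tendsto_fpsI)
    fix m
    have "fps_nth (\<Sum>k<N. G k * bfps_X ^ k) m = (\<Sum>k\<le>m. fps_nth (G k) (m - k))"
      if "N > m" for N
    proof -
      have "fps_nth (\<Sum>k<N. G k * bfps_X ^ k) m
          = (\<Sum>k<N. if m < k then 0 else fps_nth (G k) (m - k))"
        by (simp add: fps_sum_nth bfps_X_def fps_X_power_mult_right_nth)
      also have "\<dots> = (\<Sum>k\<le>m. fps_nth (G k) (m - k))"
        using that by (intro sum.mono_neutral_cong_right) auto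
      finally show ?thesis .
    qed
    then show "\<forall>\<^sub>F N in sequentially. fps_nth (\<Sum>k<N. G k * bfps_X ^ k) m
        = fps_nth (Abs_fps (\<lambda>m. \<Sum>k\<le>m. fps_nth (G k) (m - k))) m"
      by (auto intro: eventually_mono[OF eventually_gt_at_top[of m]])
  qed
  then show ?thesis
    by (auto simp: summable_def sums_def)
qed

end

theory Submission
  imports Defs "HOL-Computational_Algebra.Polynomial"
begin

text \<open>
  Umbrally, \<open>C\<^sub>N(u, \<alpha>)\<close> is \<open>(u + a)\<^sup>N\<close> under the linear functional sending \<open>a\<^sup>i\<close> to
  \<open>(\<alpha>)\<^sub>i\<close>. The left-hand side is therefore the image of
  \<open>e\<^bsup>(u + a)\<^sup>2x + (u + a)y\<^esup> = e\<^bsup>u\<^sup>2x + uy\<^esup> e\<^bsup>a(2ux + y)\<^esup> e\<^bsup>a\<^sup>2x\<^esup>\<close>, and the middle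
  factor becomes a binomial series since \<open>(\<alpha>)\<^bsub>2k + j\<^esub> = (\<alpha>)\<^bsub>2k\<^esub> (\<alpha> + 2k)\<^sub>j\<close>. Coefficientwise, the
  factorization is the expansion of \<open>(u + a)\<^bsup>2m + n\<^esup> = (u\<^sup>2 + (2ua + a\<^sup>2))\<^sup>m (u + a)\<^sup>n\<close>.
\<close>

text \<open>Cutting off at a fixed \<open>N\<close> instead of \<open>degree p\<close> makes
  additivity immediate; nothing is lost on polynomials of degree at most \<open>N\<close>.\<close>

definition umbral_eval :: "(nat \<Rightarrow> 'a::comm_semiring_1) \<Rightarrow> nat \<Rightarrow> 'a poly \<Rightarrow> 'a" where
  "umbral_eval w N p = (\<Sum>i\<le>N. coeff p i * w i)"

lemma umbral_eval_sum: "umbral_eval w N (sum f A) = (\<Sum>x\<in>A. umbral_eval w N (f x))"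
  unfolding umbral_eval_def coeff_sum sum_distrib_right by (rule sum.swap)

lemma umbral_eval_monom: "i \<le> N \<Longrightarrow> umbral_eval w N (monom c i) = c * w i"
  by (simp add: umbral_eval_def if_distrib[of "\<lambda>c. c * _"] cong: if_cong)

lemma C_conv_umbral_eval: "C N u \<alpha> = umbral_eval (pochhammer \<alpha>) N ([:u, 1:] ^ N)"
  by (simp add: C_def umbral_eval_def coeff_linear_poly_power atLeast0AtMost mult_ac)

text \<open>Two nested binomial expansions: \<open>i\<close> counts the factors u^2,
  \<open>k\<close> the factors a^2, \<open>m - i - k\<close> the factors 2ua, and \<open>l\<close>
  the factors u taken from (u + a)^n. The exponent of a stays unsimplified so that it later matches
  \<open>2 * k + a + b\<close> in the coefficients of the binomial series.\<close>

lemma linear_poly_power_expand: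
  fixes u :: "'a::comm_ring_1"
  shows "[:u, 1:] ^ (2 * m + n) =
    (\<Sum>i\<le>m. \<Sum>l\<le>n. \<Sum>k\<le>m-i. monom
      (of_nat (m choose i) * of_nat (n choose l) * of_nat ((m - i) choose k) *
        (u^2) ^ i * u ^ l * (2 * u) ^ (m - i - k))
      (2 * k + (m - i - k) + (n - l)))"
proof -
  have sq: "[:u, 1:] ^ 2 = monom (u^2) 0 + (monom 1 2 + monom (2 * u) 1)"
    by (simp add: power2_eq_square monom_altdef numeral_2_eq_2)
  have lin: "[:u, 1:] = monom u 0 + monom 1 1"
    by (simp add: monom_altdef)
  have "[:u, 1:] ^ (2 * m + n) = ([:u, 1:] ^ 2) ^ m * [:u, 1:] ^ n"
    by (simp only: power_add power_mult)
  also have "([:u, 1:] ^ 2) ^ m = (\<Sum>i\<le>m. of_nat (m choose i) * monom (u^2) 0 ^ i *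
      (\<Sum>k\<le>m-i. of_nat ((m - i) choose k) * monom 1 2 ^ k * monom (2 * u) 1 ^ (m - i - k)))"
    unfolding sq by (subst binomial_ring) (simp only: binomial_ring[of "monom 1 2"])
  also have "[:u, 1:] ^ n = (\<Sum>l\<le>n. of_nat (n choose l) * monom u 0 ^ l * monom 1 1 ^ (n - l))"
    unfolding lin by (rule binomial_ring)
  finally have "[:u, 1:] ^ (2 * m + n) = (\<Sum>i\<le>m. \<Sum>k\<le>m-i. \<Sum>l\<le>n. monom
      (of_nat (m choose i) * of_nat (n choose l) * of_nat ((m - i) choose k) *
        (u^2) ^ i * u ^ l * (2 * u) ^ (m - i - k))
      (2 * k + (m - i - k) + (n - l)))"
    by (simp add: sum_product sum_distrib_left sum_distrib_right monom_power mult_monom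
        of_nat_poly ac_simps flip: monom_0)
  \<comment> \<open>The sum over \<open>l\<close> moves outside that over \<open>k\<close>, since
    the Cauchy product in x and y runs over \<open>i\<close> and \<open>l\<close> first.\<close>
  also have "\<dots> = (\<Sum>i\<le>m. \<Sum>l\<le>n. \<Sum>k\<le>m-i. monom
      (of_nat (m choose i) * of_nat (n choose l) * of_nat ((m - i) choose k) *
        (u^2) ^ i * u ^ l * (2 * u) ^ (m - i - k))
      (2 * k + (m - i - k) + (n - l)))"
    by (intro sum.cong refl sum.swap)
  finally show ?thesis .
qed

lemma C_expand:
  "C (2 * m + n) u \<alpha> =
    (\<Sum>i\<le>m. \<Sum>l\<le>n. \<Sum>k\<le>m-i.
      of_nat (m choose i) * of_nat (n choose l) * of_nat ((m - i) choose k) *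
        (u^2) ^ i * u ^ l * (2 * u) ^ (m - i - k) * pochhammer \<alpha> (2 * k + (m - i - k) + (n - l)))"
  unfolding C_conv_umbral_eval linear_poly_power_expand umbral_eval_sum
  by (intro sum.cong refl umbral_eval_monom) auto

text \<open>The power is homogeneous of degree \<open>j\<close>, so x^m occurs only together with
  y^(j-m).\<close>

lemma bfps_coeff_linear_power:
  fixes c d :: "'a::comm_ring_1"
  shows "bfps_coeff ((bfps_const c * bfps_X + bfps_const d * bfps_Y) ^ j) m n =
    (if j = m + n then of_nat (j choose m) * c ^ m * d ^ n else 0)"
proof -
  have "(bfps_const c * bfps_X + bfps_const d * bfps_Y) ^ j =
    (\<Sum>k\<le>j. fps_const (fps_const (of_nat (j choose k) * c ^ k * d ^ (j - k)) * fps_X ^ (j - k))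
       * fps_X ^ k)"
    by (subst binomial_ring)
      (simp add: bfps_const_def bfps_X_def bfps_Y_def power_mult_distrib fps_of_nat
        fps_const_power mult_ac flip: fps_const_mult)
  then have "bfps_coeff ((bfps_const c * bfps_X + bfps_const d * bfps_Y) ^ j) m n =
    (\<Sum>k\<le>j. if k = m then if j - k = n then of_nat (j choose k) * c ^ k * d ^ (j - k) else 0 else 0)"
    unfolding bfps_coeff_def
    by (simp only: fps_sum_nth fps_X_power_mult_right_nth) (intro sum.cong refl, auto)
  then show ?thesis by auto
qed

text \<open>By homogeneity only the power \<open>j = m + n\<close> contributes, which is the last
  term of the sum in \<open>bfps_compose\<close>.\<close>

lemma bfps_coeff_compose_linear:
  fixes c d :: "'a::field_char_0"
  shows "bfps_coeff (bfps_compose f (bfps_const c * bfps_X + bfps_const d * bfps_Y)) m n =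
    fps_nth f (m + n) * fact (m + n) * c ^ m * d ^ n / (fact m * fact n)"
  by (simp add: bfps_compose_def Abs_bfps_def bfps_coeff_def[of "Abs_fps _"]
      bfps_coeff_linear_power binomial_fact if_distrib[of "\<lambda>c. _ * c"] cong: if_cong)

lemma bfps_coeff_exp_linear:
  "bfps_coeff (bfps_exp (bfps_const c * bfps_X + bfps_const d * bfps_Y)) m n =
    c ^ m * d ^ n / (fact m * fact n)"
  by (simp add: bfps_exp_def bfps_coeff_compose_linear)

text \<open>The sign in (-b gchoose j) = (-1)^j (b)_j / j! cancels against the signs of -c and
  -1.\<close>

lemma bfps_coeff_power_one_minus_linear:
  "bfps_coeff (bfps_power (1 - bfps_const c * bfps_X - bfps_Y) (- b)) m n =
    pochhammer b (m + n) * c ^ m / (fact m * fact n)"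
proof -
  have *: "1 - bfps_const c * bfps_X - bfps_Y - 1 =
      bfps_const (- c) * bfps_X + bfps_const (- 1) * bfps_Y"
    by (simp add: bfps_const_def flip: fps_const_neg)
  have "(- 1) ^ (m + n) * ((- c) ^ m * (- 1) ^ n) = c ^ m"
    by (simp add: power_add mult_ac flip: power_mult_distrib)
  then show ?thesis
    unfolding bfps_power_def * bfps_coeff_compose_linear
    by (simp add: gbinomial_pochhammer mult_ac)
qed

lemma fps_nth_suminf_bfps_X:
  fixes G :: "nat \<Rightarrow> 'a::comm_ring_1 bfps"
  shows "fps_nth (\<Sum>k. G k * bfps_X ^ k) m = (\<Sum>k\<le>m. fps_nth (G k) (m - k))"
proof -
  have *: "fps_nth (\<Sum>k<N. G k * bfps_X ^ k) m = (\<Sum>k\<le>m. fps_nth (G k) (m - k))"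
    if "N > m" for N
  proof -
    have "fps_nth (\<Sum>k<N. G k * bfps_X ^ k) m
        = (\<Sum>k<N. if m < k then 0 else fps_nth (G k) (m - k))"
      by (simp add: fps_sum_nth bfps_X_def fps_X_power_mult_right_nth)
    also have "\<dots> = (\<Sum>k\<le>m. fps_nth (G k) (m - k))"
      using that by (intro sum.mono_neutral_cong_right) auto
    finally show ?thesis .
  qed
  have "(\<lambda>N. \<Sum>k<N. G k * bfps_X ^ k) \<longlonglongrightarrow> (\<Sum>k. G k * bfps_X ^ k)"
    using summable_sums[OF summable_bfps_X] by (simp add: sums_def)
  \<comment> \<open>Convergence of formal power series means that each coefficient is eventually
    constant along the sequence.\<close>
  then have "\<forall>\<^sub>F N in sequentially.
      fps_nth (\<Sum>k<N. G k * bfps_X ^ k) m = fps_nth (\<Sum>k. G k * bfps_X ^ k) m"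
    by (simp add: tendsto_fps_iff)
  then have "\<forall>\<^sub>F N in sequentially.
      fps_nth (\<Sum>k. G k * bfps_X ^ k) m = (\<Sum>k\<le>m. fps_nth (G k) (m - k))"
    using eventually_gt_at_top[of m] by eventually_elim (simp add: *)
  then show ?thesis by simp
qed

lemma bfps_coeff_mult:
  "bfps_coeff (F * G) m n =
    (\<Sum>i\<le>m. \<Sum>l\<le>n. bfps_coeff F i l * bfps_coeff G (m - i) (n - l))"
  by (simp add: bfps_coeff_def fps_mult_nth fps_sum_nth atLeast0AtMost)

theorem theorem3p3:
  fixes u \<alpha> :: "'a::field_char_0"
  shows "Abs_bfps (\<lambda>m n. C (2 * m + n) u \<alpha> / (fact m * fact n)) =
    bfps_exp (bfps_const (u ^ 2) * bfps_X + bfps_const u * bfps_Y) *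
    (\<Sum>k. bfps_const (pochhammer \<alpha> (2 * k) / fact k) *
          bfps_power (1 - bfps_const (2 * u) * bfps_X - bfps_Y) (- (of_nat (2 * k) + \<alpha>)) *
          bfps_X ^ k)"
    (is "?L = ?E * (\<Sum>k. ?G k * bfps_X ^ k)")
proof -
  have G: "bfps_coeff (?G k) a b =
      pochhammer \<alpha> (2 * k + a + b) * (2 * u) ^ a / (fact k * fact a * fact b)" for k a b
  proof -
    have "bfps_coeff (?G k) a b = pochhammer \<alpha> (2 * k) / fact k *
        bfps_coeff (bfps_power (1 - bfps_const (2 * u) * bfps_X - bfps_Y)
          (- (of_nat (2 * k) + \<alpha>))) a b"
      by (simp add: bfps_coeff_def bfps_const_def)
    also have "\<dots> = pochhammer \<alpha> (2 * k) * pochhammer (\<alpha> + of_nat (2 * k)) (a + b) *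
        (2 * u) ^ a / (fact k * fact a * fact b)"
      unfolding bfps_coeff_power_one_minus_linear by (simp add: add.commute mult_ac)
    finally show ?thesis
      by (simp only: pochhammer_product'[symmetric] add.assoc)
  qed
  have S: "bfps_coeff (\<Sum>k. ?G k * bfps_X ^ k) m n = (\<Sum>k\<le>m. bfps_coeff (?G k) (m - k) n)" for m n
    by (simp only: bfps_coeff_def fps_nth_suminf_bfps_X fps_sum_nth)
  have "bfps_coeff ?L m n = bfps_coeff (?E * (\<Sum>k. ?G k * bfps_X ^ k)) m n" for m n
  proof -
    have "bfps_coeff ?L m n = C (2 * m + n) u \<alpha> / (fact m * fact n)"
      by (simp add: bfps_coeff_def Abs_bfps_def)
    \<comment> \<open>Dividing by m! n! splits the binomials: (m choose i) (m-i choose k) / m! = 1 /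
      (i! k! (m-i-k)!) and (n choose l) / n! = 1 / (l! (n-l)!).\<close>
    also have "\<dots> = (\<Sum>i\<le>m. \<Sum>l\<le>n. \<Sum>k\<le>m-i. (u^2) ^ i * u ^ l / (fact i * fact l) *
        (pochhammer \<alpha> (2 * k + (m - i - k) + (n - l)) * (2 * u) ^ (m - i - k) /
          (fact k * fact (m - i - k) * fact (n - l))))"
      unfolding C_expand sum_divide_distrib
      by (intro sum.cong refl) (simp add: binomial_fact mult_ac)
    also have "\<dots> = bfps_coeff (?E * (\<Sum>k. ?G k * bfps_X ^ k)) m n"
      by (subst bfps_coeff_mult) (simp only: S G bfps_coeff_exp_linear sum_distrib_left)
    finally show ?thesis .
  qed
  then show ?thesis
    by (auto simp: bfps_coeff_def fps_eq_iff)
qed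

end
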